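(* Let $G$ be a finite simple graph with $\mathrm{mad}(G)<3$. Then $\chi'_a(G)\leq \Delta(G)+1$.
   Context: A proper edge coloring of a graph is acyclic if there is no bichromatic cycle, i.e. the union of any two color classes induces a forest. The acyclic chromatic index $\chi'_a(G)$ is the least $k$ such that $G$ has an acyclic proper edge coloring with $k$ colors. $\Delta(G)$ is the maximum degree. The maximum average degree is $\mathrm{mad}(G)=\max_{H\subseteq G}\frac{2|E(H)|}{|V(H)|}$, the maximum over all (nonempty) subgraphs $H$. *)

theory Defs
  imports Complex_Main
begin

text \<open>A simple graph is given by its vertex set and its set of edges, each edge being a set of
  two distinct vertices.\<close>

definition simple_graph :: "'a set \<Rightarrow> 'a set set \<Rightarrow> bool" where
  "simple_graph V E \<longleftrightarrow> (\<forall>e\<in>E. e \<subseteq> V \<and> card e = 2)"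

definition subgraph :: "'a set \<Rightarrow> 'a set set \<Rightarrow> 'a set \<Rightarrow> 'a set set \<Rightarrow> bool" where
  "subgraph W F V E \<longleftrightarrow> simple_graph W F \<and> W \<subseteq> V \<and> F \<subseteq> E"

definition degree :: "'a set set \<Rightarrow> 'a \<Rightarrow> nat" where
  "degree E v = card {e \<in> E. v \<in> e}"

text \<open>For a finite nonempty graph the two maxima below range over finite nonempty sets; the graph
  without vertices gets the value 0.\<close>

definition max_degree :: "'a set \<Rightarrow> 'a set set \<Rightarrow> nat" where
  "max_degree V E = (if V = {} then 0 else Max {degree E v | v. v \<in> V})"

definition max_average_degree :: "'a set \<Rightarrow> 'a set set \<Rightarrow> real" where
  "max_average_degree V E =
    (if V = {} then 0
     else Max {2 * real (card F) / real (card W) | W F. subgraph W F V E \<and> W \<noteq> {}})"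

text \<open>A cycle is listed by its vertices, without repeating the initial vertex at the end.\<close>

definition is_cycle :: "'a set set \<Rightarrow> 'a list \<Rightarrow> bool" where
  "is_cycle E xs \<longleftrightarrow> 3 \<le> length xs \<and> distinct xs \<and>
    (\<forall>i<length xs. {xs ! i, xs ! (Suc i mod length xs)} \<in> E)"

definition forest :: "'a set set \<Rightarrow> bool" where
  "forest E \<longleftrightarrow> (\<nexists>xs. is_cycle E xs)"

definition proper_edge_coloring :: "'a set set \<Rightarrow> nat \<Rightarrow> ('a set \<Rightarrow> nat) \<Rightarrow> bool" where
  "proper_edge_coloring E k c \<longleftrightarrow> (\<forall>e\<in>E. c e < k) \<and>
    (\<forall>e\<in>E. \<forall>f\<in>E. e \<noteq> f \<and> e \<inter> f \<noteq> {} \<longrightarrow> c e \<noteq> c f)"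

definition acyclic_edge_coloring :: "'a set set \<Rightarrow> nat \<Rightarrow> ('a set \<Rightarrow> nat) \<Rightarrow> bool" where
  "acyclic_edge_coloring E k c \<longleftrightarrow> proper_edge_coloring E k c \<and>
    (\<forall>a b. forest {e \<in> E. c e = a \<or> c e = b})"

text \<open>For finite \<open>E\<close> the minimum exists: give all edges different colors.\<close>

definition acyclic_chromatic_index :: "'a set set \<Rightarrow> nat" where
  "acyclic_chromatic_index E = (LEAST k. \<exists>c. acyclic_edge_coloring E k c)"

end

theory Submission
  imports Defs
begin

text \<open>
  Let \<open>k\<close> exceed all degrees. Discharging yields an edge \<open>uv\<close> such that \<open>u\<close> is a leaf, or \<open>u\<close> has degree
  two and either \<open>v\<close> has degree three or at most one neighbor \<open>x\<close> of \<open>v\<close> has degree above two. Color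
  \<open>G - uv\<close> inductively and let \<open>w\<close> be the other neighbor of \<open>u\<close>. The edge \<open>uw\<close> is now pendant, so it can be
  recolored with any color missing at \<open>w\<close>; a color of \<open>uv\<close> fails only if it closes a
  bichromatic cycle through \<open>w u v z\<close>, where \<open>vz\<close> has the color of \<open>uw\<close>.

  If only \<open>x\<close> is heavy, recolor \<open>uw\<close> differently from \<open>vx\<close>. Then \<open>z\<close> has degree at most two, so it
  forbids at most one of the two or more colors free at \<open>v\<close>.

  If \<open>v\<close> has further neighbors \<open>v1\<close> and \<open>v2\<close>, with \<open>vv1\<close> colored \<open>p\<close> like \<open>uw\<close> and \<open>vv2\<close> colored \<open>q\<close>,
  and no color works, then \<open>q\<close> is missing at \<open>w\<close> and \<open>v1\<close>, and, after recoloring \<open>uw\<close> with \<open>q\<close>,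
  \<open>p\<close> is missing at \<open>v2\<close>. Hence \<open>p\<close> and \<open>q\<close> can be
  swapped at \<open>v\<close>, and since the alternating path from \<open>w\<close> leads to \<open>v1\<close>, it no longer closes up.
\<close>

section \<open>Neighborhoods, colors at a vertex, and bichromatic cores\<close>

definition nbrs :: "'a set set \<Rightarrow> 'a \<Rightarrow> 'a set" where
  "nbrs E v = {x. {v, x} \<in> E}"

definition colors_at :: "'a set set \<Rightarrow> ('a set \<Rightarrow> nat) \<Rightarrow> 'a \<Rightarrow> nat set" where
  "colors_at E c v = (\<lambda>x. c {v, x}) ` nbrs E v"

text \<open>The vertex set of a bichromatic cycle is a core. Excluding cores instead of cycles spares the
  induction all reasoning about paths.\<close>

definition bichromatic_core ::
    "'a set set \<Rightarrow> ('a set \<Rightarrow> nat) \<Rightarrow> nat \<Rightarrow> nat \<Rightarrow> 'a set \<Rightarrow> bool" where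
  "bichromatic_core E c a b S \<longleftrightarrow> S \<noteq> {} \<and>
    (\<forall>v\<in>S. (\<exists>x\<in>S. {v, x} \<in> E \<and> c {v, x} = a) \<and> (\<exists>x\<in>S. {v, x} \<in> E \<and> c {v, x} = b))"

text \<open>The colors must differ because the two ends of a single edge colored \<open>a\<close>
  already satisfy the core condition for \<open>a = b\<close>.\<close>

definition core_free_coloring :: "'a set set \<Rightarrow> nat \<Rightarrow> ('a set \<Rightarrow> nat) \<Rightarrow> bool" where
  "core_free_coloring E k c \<longleftrightarrow> proper_edge_coloring E k c \<and>
    (\<forall>a b S. a \<noteq> b \<longrightarrow> \<not> bichromatic_core E c a b S)"

text \<open>Properness gives the two cycle edges at a vertex different colors, so the vertices of
  the cycle form a core. This also settles \<open>a = b\<close>, since a proper coloring has no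
  monochromatic cycle.\<close>

lemma core_free_imp_acyclic:
  assumes "core_free_coloring E k c"
  shows "acyclic_edge_coloring E k c"
proof -
  have proper: "proper_edge_coloring E k c"
    and nocore: "\<And>a b S. a \<noteq> b \<Longrightarrow> \<not> bichromatic_core E c a b S"
    using assms by (auto simp: core_free_coloring_def)
  have "\<not> is_cycle {e \<in> E. c e = a \<or> c e = b} xs" for a b xs
  proof
    assume cyc: "is_cycle {e \<in> E. c e = a \<or> c e = b} xs"
    define n where "n = length xs"
    have n: "3 \<le> n" and dist: "distinct xs"
      and edge: "\<And>i. i < n \<Longrightarrow> {xs ! i, xs ! (Suc i mod n)} \<in> E \<and>
        (c {xs ! i, xs ! (Suc i mod n)} = a \<or> c {xs ! i, xs ! (Suc i mod n)} = b)"
      using cyc by (auto simp: is_cycle_def n_def)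
    have two: "(\<exists>x\<in>set xs. {v, x} \<in> E \<and> c {v, x} = a) \<and> (\<exists>x\<in>set xs. {v, x} \<in> E \<and> c {v, x} = b) \<and> a \<noteq> b"
      if vin: "v \<in> set xs" for v
    proof -
      obtain i where i: "i < n" "v = xs ! i" using vin by (metis in_set_conv_nth n_def)
      \<comment> \<open>\<open>j\<close> and \<open>l\<close> are the cyclic predecessor and
        successor of \<open>i\<close>; they differ because the cycle has length at least
        three.\<close>
      define j where "j = (if i = 0 then n - 1 else i - 1)"
      define l where "l = Suc i mod n"
      have j: "j < n" "Suc j mod n = i" using i n by (auto simp: j_def)
      have l: "l < n" using n by (simp add: l_def)
      have "j \<noteq> l" using i n by (auto simp: j_def l_def mod_Suc split: if_splits)
      moreover have "j \<noteq> i" using i n by (auto simp: j_def)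
      ultimately have ne: "xs ! j \<noteq> xs ! l" "xs ! j \<noteq> xs ! i"
        using dist i j l by (auto simp: nth_eq_iff_index_eq n_def)
      have ej: "{v, xs ! j} \<in> E" "c {v, xs ! j} = a \<or> c {v, xs ! j} = b"
        using edge[OF j(1)] j(2) i by (auto simp: insert_commute)
      have el: "{v, xs ! l} \<in> E" "c {v, xs ! l} = a \<or> c {v, xs ! l} = b"
        using edge[OF i(1)] i by (auto simp: l_def)
      have "{v, xs ! j} \<noteq> {v, xs ! l}" using ne by (auto simp: doubleton_eq_iff)
      then have "c {v, xs ! j} \<noteq> c {v, xs ! l}"
        using proper ej(1) el(1) by (auto simp: proper_edge_coloring_def)
      moreover have "xs ! j \<in> set xs" "xs ! l \<in> set xs" using j l by (auto simp: n_def)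
      ultimately show ?thesis using ej el by metis
    qed
    have "set xs \<noteq> {}" using n by (auto simp: n_def)
    then obtain v where "v \<in> set xs" by (metis all_not_in_conv)
    then have "a \<noteq> b" using two by blast
    moreover have "bichromatic_core E c a b (set xs)"
      using two \<open>set xs \<noteq> {}\<close> unfolding bichromatic_core_def by blast
    ultimately show False using nocore by blast
  qed
  with proper show ?thesis by (simp add: acyclic_edge_coloring_def forest_def)
qed

lemma bichromatic_core_commute: "bichromatic_core E c a b S \<longleftrightarrow> bichromatic_core E c b a S"
  by (auto simp: bichromatic_core_def)

lemma bichromatic_core_nbrs:
  assumes "bichromatic_core E c a b S" "v \<in> S"
  shows "\<exists>x\<in>S. {v, x} \<in> E \<and> c {v, x} = a" "\<exists>x\<in>S. {v, x} \<in> E \<and> c {v, x} = b"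
  using assms unfolding bichromatic_core_def by blast+

lemma core_free_coloring_mono:
  assumes "core_free_coloring E k c" "F \<subseteq> E"
  shows "core_free_coloring F k c"
proof -
  have "bichromatic_core F c a b S \<Longrightarrow> bichromatic_core E c a b S" for a b S
    using assms(2) unfolding bichromatic_core_def by blast
  then show ?thesis using assms
    unfolding core_free_coloring_def proper_edge_coloring_def by (meson in_mono)
qed

section \<open>Extending a coloring by one edge and recoloring pendant edges\<close>

lemma colors_at_iff: "\<gamma> \<in> colors_at E c v \<longleftrightarrow> (\<exists>x. {v, x} \<in> E \<and> c {v, x} = \<gamma>)"
  by (auto simp: colors_at_def nbrs_def)

lemma colors_at_cong:
  assumes "\<And>x. {v, x} \<in> E \<Longrightarrow> c {v, x} = d {v, x}"
  shows "colors_at E c v = colors_at E d v"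
  using assms by (auto simp: colors_at_def nbrs_def)

lemma edge_endpoints:
  assumes "card e = 2" "v \<in> e"
  obtains x where "e = {v, x}" "x \<noteq> v"
proof -
  obtain p q where "e = {p, q}" "p \<noteq> q" using assms(1) by (meson card_2_iff)
  with assms(2) that show thesis by auto
qed

lemma proper_unique_nbr:
  assumes "proper_edge_coloring E k c" "{v, x} \<in> E" "{v, y} \<in> E" "c {v, x} = c {v, y}"
  shows "x = y"
proof -
  have "{v, x} \<inter> {v, y} \<noteq> {}" by simp
  then have "{v, x} = {v, y}" using assms unfolding proper_edge_coloring_def by metis
  then show ?thesis by (auto simp: doubleton_eq_iff)
qed

lemma proper_color_extend:
  assumes proper: "proper_edge_coloring E k c"
    and card2: "\<And>e. e \<in> E \<Longrightarrow> card e = 2"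
    and g: "\<gamma> < k" "\<gamma> \<notin> colors_at E c u" "\<gamma> \<notin> colors_at E c v"
  shows "proper_edge_coloring (insert {u, v} E) k (c({u, v} := \<gamma>))"
proof -
  have *: "c e \<noteq> \<gamma>" if e: "e \<in> E" "e \<inter> {u, v} \<noteq> {}" for e
  proof -
    obtain z where "z \<in> e" "z = u \<or> z = v" using e by blast
    moreover obtain x where "e = {z, x}" using edge_endpoints[OF card2[OF e(1)] \<open>z \<in> e\<close>] by metis
    ultimately show ?thesis using g e(1) by (auto simp: colors_at_iff)
  qed
  show ?thesis unfolding proper_edge_coloring_def
  proof (intro conjI ballI impI)
    fix e assume "e \<in> insert {u, v} E"
    then show "(c({u, v} := \<gamma>)) e < k" using g proper by (auto simp: proper_edge_coloring_def)
  next
    fix e f assume "e \<in> insert {u, v} E" "f \<in> insert {u, v} E" "e \<noteq> f \<and> e \<inter> f \<noteq> {}"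
    then show "(c({u, v} := \<gamma>)) e \<noteq> (c({u, v} := \<gamma>)) f"
      using proper *[of e] *[of f] by (auto simp: proper_edge_coloring_def Int_commute)
  qed
qed

text \<open>A core that misses an end of \<open>uv\<close>, or whose colors both differ from
  \<open>\<gamma>\<close>, makes no use of the new edge and is a core of the old coloring.\<close>

lemma core_free_extend:
  assumes cf: "core_free_coloring E k c"
    and card2: "\<And>e. e \<in> E \<Longrightarrow> card e = 2"
    and new: "{u, v} \<notin> E"
    and g: "\<gamma> < k" "\<gamma> \<notin> colors_at E c u" "\<gamma> \<notin> colors_at E c v"
    and nocore: "\<And>\<beta> S. \<beta> \<noteq> \<gamma> \<Longrightarrow> u \<in> S \<Longrightarrow> v \<in> S \<Longrightarrow>
      \<not> bichromatic_core (insert {u, v} E) (c({u, v} := \<gamma>)) \<gamma> \<beta> S"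
  shows "core_free_coloring (insert {u, v} E) k (c({u, v} := \<gamma>))"
proof -
  let ?E = "insert {u, v} E" and ?c = "c({u, v} := \<gamma>)"
  have "\<not> bichromatic_core ?E ?c a b S" if ab: "a \<noteq> b" for a b S
  proof
    assume core: "bichromatic_core ?E ?c a b S"
    consider "u \<in> S" "v \<in> S" "a = \<gamma>" | "u \<in> S" "v \<in> S" "b = \<gamma>"
      | "u \<notin> S \<or> v \<notin> S \<or> (a \<noteq> \<gamma> \<and> b \<noteq> \<gamma>)" by blast
    then show False
    proof cases
      case 1 then show ?thesis using nocore core ab by metis
    next
      case 2 then show ?thesis using nocore core ab bichromatic_core_commute by metis
    next
      case 3
      have *: "{y, x} \<in> E \<and> c {y, x} = ?c {y, x}"
        if "y \<in> S" "x \<in> S" "{y, x} \<in> ?E" "?c {y, x} = a \<or> ?c {y, x} = b" for x y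
      proof (cases "{y, x} = {u, v}")
        case True
        then have "u \<in> S" "v \<in> S" using that by (auto simp: doubleton_eq_iff)
        then show ?thesis using 3 that True by auto
      next
        case False
        then show ?thesis using that by auto
      qed
      have "bichromatic_core E c a b S"
        unfolding bichromatic_core_def
      proof (intro conjI ballI)
        show "S \<noteq> {}" using core by (simp add: bichromatic_core_def)
      next
        fix y assume y: "y \<in> S"
        obtain x z where "x \<in> S" "{y, x} \<in> ?E" "?c {y, x} = a" "z \<in> S" "{y, z} \<in> ?E" "?c {y, z} = b"
          using bichromatic_core_nbrs[OF core y] by auto
        then show "\<exists>x\<in>S. {y, x} \<in> E \<and> c {y, x} = a" "\<exists>x\<in>S. {y, x} \<in> E \<and> c {y, x} = b"
          using * y by metis+
      qed
      then show ?thesis using cf ab by (auto simp: core_free_coloring_def)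
    qed
  qed
  moreover have "proper_edge_coloring ?E k ?c"
    using proper_color_extend[OF _ card2 g] cf by (auto simp: core_free_coloring_def)
  ultimately show ?thesis by (auto simp: core_free_coloring_def)
qed

text \<open>The new edge is colored \<open>\<gamma>\<close>, so the \<open>\<beta>\<close>-edges at
  \<open>u\<close> and \<open>v\<close> are old, and the one at \<open>u\<close> can only be
  \<open>uw\<close>. Neither \<open>w\<close> nor \<open>z\<close> is an end of the new edge, so
  their \<open>\<gamma>\<close>-edges are old as well. The inclusion in \<open>pend\<close> admits
  an isolated \<open>u\<close>; then the conclusion is absurd, so no such core exists.\<close>

lemma core_at_new_edge:
  assumes core: "bichromatic_core (insert {u, v} E) (c({u, v} := \<gamma>)) \<gamma> \<beta> S"
    and card2: "\<And>e. e \<in> E \<Longrightarrow> card e = 2"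
    and S: "u \<in> S" "v \<in> S" and "\<beta> \<noteq> \<gamma>" and new: "{u, v} \<notin> E"
    and pend: "nbrs E u \<subseteq> {w}"
  obtains z where "{u, w} \<in> E" "c {u, w} = \<beta>" "w \<in> S" "\<gamma> \<in> colors_at E c w"
    "{v, z} \<in> E" "c {v, z} = \<beta>" "z \<in> S" "\<gamma> \<in> colors_at E c z"
proof -
  let ?E = "insert {u, v} E" and ?c = "c({u, v} := \<gamma>)"
  have away: "\<gamma> \<in> colors_at E c y" if y: "y \<in> S" "y \<noteq> u" "y \<noteq> v" for y
  proof -
    obtain x where "{y, x} \<in> ?E" "?c {y, x} = \<gamma>" using bichromatic_core_nbrs(1)[OF core y(1)] by auto
    moreover have "{y, x} \<noteq> {u, v}" using y by (auto simp: doubleton_eq_iff)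
    ultimately show ?thesis by (auto simp: colors_at_iff)
  qed
  have step: "\<exists>x\<in>S. {y, x} \<in> E \<and> c {y, x} = \<beta>" if y: "y \<in> S" for y
  proof -
    obtain x where "x \<in> S" "{y, x} \<in> ?E" "?c {y, x} = \<beta>" using bichromatic_core_nbrs(2)[OF core y] by auto
    moreover from this have "{y, x} \<noteq> {u, v}" using \<open>\<beta> \<noteq> \<gamma>\<close> by auto
    ultimately show ?thesis by auto
  qed
  obtain x where x: "x \<in> S" "{u, x} \<in> E" "c {u, x} = \<beta>" using step[OF S(1)] by blast
  then have xw: "x = w" using pend by (auto simp: nbrs_def)
  obtain z where z: "z \<in> S" "{v, z} \<in> E" "c {v, z} = \<beta>" using step[OF S(2)] by blast
  have "w \<noteq> u" "z \<noteq> v" using card2[OF x(2)] card2[OF z(2)] xw by auto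
  moreover have "w \<noteq> v" "z \<noteq> u" using x z xw new by (auto simp: insert_commute)
  ultimately show thesis using that x z xw away by blast
qed

text \<open>For a color that keeps \<open>uv\<close> proper, only a core can obstruct the extension,
  and its second color must be that of \<open>uw\<close>, the sole edge of \<open>u\<close> in
  \<open>E\<close>.\<close>

lemma pendant_extend_or_core:
  assumes cf: "core_free_coloring E k c"
    and card2: "\<And>e. e \<in> E \<Longrightarrow> card e = 2"
    and new: "{u, v} \<notin> E" and pend: "nbrs E u = {w}"
    and g: "\<gamma> < k" "\<gamma> \<noteq> c {u, w}" "\<gamma> \<notin> colors_at E c v"
    and none: "\<nexists>d. core_free_coloring (insert {u, v} E) k d"
  obtains z S where "{v, z} \<in> E" "c {v, z} = c {u, w}"
    "\<gamma> \<in> colors_at E c w" "\<gamma> \<in> colors_at E c z"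
    "bichromatic_core (insert {u, v} E) (c({u, v} := \<gamma>)) \<gamma> (c {u, w}) S" "v \<in> S"
proof -
  have gu: "\<gamma> \<notin> colors_at E c u" using g(2) pend by (auto simp: colors_at_def)
  obtain \<beta> S where bS: "\<beta> \<noteq> \<gamma>" "u \<in> S" "v \<in> S"
    "bichromatic_core (insert {u, v} E) (c({u, v} := \<gamma>)) \<gamma> \<beta> S"
    using core_free_extend[OF cf card2 new g(1) gu g(3)] none by blast
  obtain z where "c {u, w} = \<beta>" "\<gamma> \<in> colors_at E c w" "{v, z} \<in> E" "c {v, z} = \<beta>"
    "\<gamma> \<in> colors_at E c z"
    using core_at_new_edge[OF bS(4) card2 bS(2,3,1) new] pend by blast
  with that bS show thesis by blast
qed

text \<open>Once \<open>uw\<close> is deleted, \<open>u\<close> is isolated, so no core can arise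
  when the edge is put back in a new color.\<close>

lemma core_free_recolor_pendant:
  assumes cf: "core_free_coloring E k c"
    and card2: "\<And>e. e \<in> E \<Longrightarrow> card e = 2"
    and pend: "nbrs E u = {w}"
    and g: "\<gamma> < k" "\<gamma> \<notin> colors_at (E - {{u, w}}) c w"
  shows "core_free_coloring E k (c({u, w} := \<gamma>))"
proof -
  let ?F = "E - {{u, w}}"
  have iso: "nbrs ?F u = {}" using pend by (auto simp: nbrs_def)
  have uw: "{u, w} \<in> E" using pend by (auto simp: nbrs_def)
  have "core_free_coloring (insert {u, w} ?F) k (c({u, w} := \<gamma>))"
  proof (rule core_free_extend)
    show "core_free_coloring ?F k c" using cf core_free_coloring_mono by blast
    show "\<gamma> \<notin> colors_at ?F c u" using iso by (simp add: colors_at_def)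
    show "\<not> bichromatic_core (insert {u, w} ?F) (c({u, w} := \<gamma>)) \<gamma> \<beta> S"
      if "\<beta> \<noteq> \<gamma>" "u \<in> S" "w \<in> S" for \<beta> S
      using core_at_new_edge[of u w ?F c \<gamma> \<beta> S w] card2 that iso by auto
  qed (use card2 g in auto)
  then show ?thesis using uw by (simp add: insert_absorb)
qed

section \<open>Counting neighbors and available colors\<close>

lemma card_nbrs:
  assumes "\<And>e. e \<in> E \<Longrightarrow> card e = 2"
  shows "card (nbrs E v) = degree E v"
proof -
  have "bij_betw (\<lambda>x. {v, x}) (nbrs E v) {e \<in> E. v \<in> e}"
    unfolding bij_betw_def
  proof
    show "inj_on (\<lambda>x. {v, x}) (nbrs E v)" by (auto simp: inj_on_def doubleton_eq_iff)
    show "(\<lambda>x. {v, x}) ` nbrs E v = {e \<in> E. v \<in> e}"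
    proof (intro equalityI subsetI)
      fix e assume "e \<in> {e \<in> E. v \<in> e}"
      then have e: "e \<in> E" "v \<in> e" by auto
      obtain x where "e = {v, x}" using edge_endpoints[OF assms[OF e(1)] e(2)] by metis
      then show "e \<in> (\<lambda>x. {v, x}) ` nbrs E v" using e by (auto simp: nbrs_def)
    qed (auto simp: nbrs_def)
  qed
  then show ?thesis by (simp add: degree_def bij_betw_same_card)
qed

lemma finite_nbrs:
  assumes "finite E"
  shows "finite (nbrs E v)"
proof (rule finite_imageD)
  show "finite ((\<lambda>x. {v, x}) ` nbrs E v)"
    by (rule finite_subset[OF _ assms]) (auto simp: nbrs_def)
qed (auto simp: inj_on_def doubleton_eq_iff)

lemma finite_colors_at: "finite E \<Longrightarrow> finite (colors_at E c v)"
  by (simp add: colors_at_def finite_nbrs)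

lemma card_colors_at_le: "finite E \<Longrightarrow> card (colors_at E c v) \<le> card (nbrs E v)"
  by (simp add: colors_at_def finite_nbrs card_image_le)

lemma nbrs_delete:
  assumes "u \<noteq> v"
  shows "nbrs (E - {{u, v}}) v = nbrs E v - {u}" "nbrs (E - {{u, v}}) u = nbrs E u - {v}"
  using assms by (auto simp: nbrs_def doubleton_eq_iff)

lemma ex_color_avoiding:
  assumes "finite A" "card A < k"
  obtains \<gamma> :: nat where "\<gamma> < k" "\<gamma> \<notin> A"
proof -
  have "\<not> {..<k} \<subseteq> A" using assms card_mono[of A "{..<k}"] by auto
  with that show thesis by blast
qed

section \<open>Reductions at a leaf and at a vertex with mostly light neighbors\<close>

lemma reduce_degree_one:
  assumes fin: "finite E" and card2: "\<And>e. e \<in> E \<Longrightarrow> card e = 2"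
    and e: "{u, v} \<in> E" and u: "nbrs E u = {v}" and deg: "card (nbrs E v) < k"
    and cf: "core_free_coloring (E - {{u, v}}) k c"
  shows "\<exists>d. core_free_coloring E k d"
proof -
  let ?F = "E - {{u, v}}"
  have uv: "u \<noteq> v" using card2[OF e] by auto
  have "card (colors_at ?F c v) \<le> card (nbrs E v)"
    using card_colors_at_le[of ?F c v] fin nbrs_delete[OF uv] card_mono[OF finite_nbrs[OF fin], of "nbrs E v - {u}"]
    by force
  then obtain \<gamma> where g: "\<gamma> < k" "\<gamma> \<notin> colors_at ?F c v"
    using ex_color_avoiding[OF finite_colors_at, of ?F c v k] fin deg by auto
  have iso: "nbrs ?F u = {}" using nbrs_delete(2)[OF uv] u by simp
  have "core_free_coloring (insert {u, v} ?F) k (c({u, v} := \<gamma>))"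
  proof (rule core_free_extend[OF cf])
    show "\<gamma> \<notin> colors_at ?F c u" using iso by (simp add: colors_at_def)
    \<comment> \<open>A core would need a second edge at \<open>u\<close>, which is isolated in
      \<open>?F\<close>.\<close>
    show "\<not> bichromatic_core (insert {u, v} ?F) (c({u, v} := \<gamma>)) \<gamma> \<beta> S"
      if "\<beta> \<noteq> \<gamma>" "u \<in> S" "v \<in> S" for \<beta> S
      using core_at_new_edge[of u v ?F c \<gamma> \<beta> S v] card2 that iso by auto
  qed (use card2 g in auto)
  then show ?thesis using e by (auto simp: insert_absorb)
qed

lemma reduce_mostly_light_nbrs:
  assumes fin: "finite E" and card2: "\<And>e. e \<in> E \<Longrightarrow> card e = 2"
    and e: "{u, v} \<in> E" and u: "card (nbrs E u) = 2"
    and deg: "\<And>z. card (nbrs E z) < k"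
    and light: "\<And>z. z \<in> nbrs E v \<Longrightarrow> z \<noteq> x \<Longrightarrow> card (nbrs E z) \<le> 2"
    and cf: "core_free_coloring (E - {{u, v}}) k c"
  shows "\<exists>d. core_free_coloring E k d"
proof (rule ccontr)
  assume none: "\<nexists>d. core_free_coloring E k d"
  let ?F = "E - {{u, v}}"
  have uv: "u \<noteq> v" using card2[OF e] by auto
  have vu: "v \<in> nbrs E u" "u \<in> nbrs E v" using e by (auto simp: nbrs_def insert_commute)
  have "card (nbrs ?F u) = 1" using nbrs_delete(2)[OF uv] vu u by simp
  then obtain w where w: "nbrs ?F u = {w}" by (meson card_1_singletonE)
  have uwE: "{u, w} \<in> ?F" using w by (auto simp: nbrs_def)
  have wuv: "w \<noteq> u" "w \<noteq> v" using card2[of "{u, w}"] uwE by auto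
  have insE: "insert {u, v} ?F = E" using e by auto
  have finF: "finite ?F" and card2F: "\<And>e. e \<in> ?F \<Longrightarrow> card e = 2" using fin card2 by auto
  let ?W = "colors_at (?F - {{u, w}}) c w"
  have "nbrs (?F - {{u, w}}) w \<subseteq> nbrs E w - {u}"
    using nbrs_delete(1)[OF wuv(1)[symmetric]] by (auto simp: nbrs_def)
  moreover have "u \<in> nbrs E w" using uwE by (auto simp: nbrs_def insert_commute)
  ultimately have "card (nbrs (?F - {{u, w}}) w) < card (nbrs E w)"
    using finite_nbrs[OF fin] by (meson card_Diff1_less card_mono finite_Diff le_less_trans)
  \<comment> \<open>Apart from \<open>uw\<close>, the vertex \<open>w\<close> has at most
    \<open>k - 2\<close> edges, so at least two colors are available for \<open>uw\<close>, and one
    of them differs from \<open>c {v, x}\<close>. If \<open>x\<close> is not a neighbor of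
    \<open>v\<close>, this is just some value to avoid.\<close>
  then have "card ?W + 1 < k"
    using card_colors_at_le[of "?F - {{u, w}}" c w] finF deg[of w] by fastforce
  then have "card (insert (c {v, x}) ?W) < k"
    using finite_colors_at[of "?F - {{u, w}}" c w] finF by (simp add: card_insert_if)
  then obtain \<beta> where b: "\<beta> < k" "\<beta> \<notin> ?W" "\<beta> \<noteq> c {v, x}"
    using ex_color_avoiding[of "insert (c {v, x}) ?W" k] finF finite_colors_at[of "?F - {{u, w}}" c w] by auto
  define d where "d = c({u, w} := \<beta>)"
  have cfd: "core_free_coloring ?F k d"
    unfolding d_def by (rule core_free_recolor_pendant[OF cf card2F w b(1,2)])
  have dv: "d {v, y} = c {v, y}" for y
    using uv wuv by (auto simp: d_def doubleton_eq_iff)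
  have duw: "d {u, w} = \<beta>" by (simp add: d_def)
  have "card (nbrs ?F v) + 1 = card (nbrs E v)"
    using nbrs_delete(1)[OF uv] vu finite_nbrs[OF fin] by (metis Suc_eq_plus1 card_Suc_Diff1)
  then have cv: "card (colors_at ?F d v) + 2 \<le> k"
    using card_colors_at_le[OF finF, of d v] deg[of v] by linarith
  obtain \<gamma> where g: "\<gamma> < k" "\<gamma> \<notin> colors_at ?F d v" "\<gamma> \<noteq> \<beta>"
    and gz: "\<And>z. {v, z} \<in> ?F \<Longrightarrow> d {v, z} = \<beta> \<Longrightarrow> \<gamma> \<notin> colors_at ?F d z"
  proof (cases "\<exists>z. {v, z} \<in> ?F \<and> d {v, z} = \<beta>")
    case False
    have "card (insert \<beta> (colors_at ?F d v)) < k"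
      using cv finite_colors_at[OF finF, of d v] by (simp add: card_insert_if)
    then obtain \<gamma> where "\<gamma> < k" "\<gamma> \<notin> insert \<beta> (colors_at ?F d v)"
      using ex_color_avoiding[of "insert \<beta> (colors_at ?F d v)" k] finite_colors_at[OF finF] by blast
    then show ?thesis using False by (intro that[of \<gamma>]) auto
  next
    case True
    then obtain z where z: "{v, z} \<in> ?F" "d {v, z} = \<beta>" by blast
    have "z \<noteq> x" using b(3) dv z(2) by metis
    then have "card (nbrs E z) \<le> 2" using light z(1) by (simp add: nbrs_def)
    moreover have "card (nbrs ?F z) \<le> card (nbrs E z)"
      using finite_nbrs[OF fin] by (rule card_mono) (auto simp: nbrs_def)
    ultimately have cz: "card (colors_at ?F d z) \<le> 2" using card_colors_at_le[OF finF, of d z] by linarith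
    have bv: "\<beta> \<in> colors_at ?F d v" and bz: "\<beta> \<in> colors_at ?F d z"
      using z by (auto simp: colors_at_iff insert_commute)
    \<comment> \<open>\<open>\<beta>\<close> lies in both color sets, on the edge \<open>vz\<close>,
      so the light vertex \<open>z\<close> adds at most one forbidden color to those at
      \<open>v\<close>.\<close>
    let ?A = "colors_at ?F d v \<union> (colors_at ?F d z - {\<beta>})"
    have "card (colors_at ?F d z - {\<beta>}) \<le> 1" using bz cz finite_colors_at[OF finF, of d z] by simp
    then have "card ?A < k" using card_Un_le[of "colors_at ?F d v" "colors_at ?F d z - {\<beta>}"] cv by linarith
    then obtain \<gamma> where g: "\<gamma> < k" "\<gamma> \<notin> ?A"
      using ex_color_avoiding[of ?A k] finite_colors_at[OF finF] by auto
    have "z' = z" if "{v, z'} \<in> ?F" "d {v, z'} = \<beta>" for z'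
      using proper_unique_nbr[OF _ that(1) z(1)] z(2) that(2) cfd by (auto simp: core_free_coloring_def)
    with g bv that show ?thesis by blast
  qed
  have new: "{u, v} \<notin> ?F" and gu: "\<gamma> \<noteq> d {u, w}" using g(3) duw by auto
  have none': "\<nexists>d. core_free_coloring (insert {u, v} ?F) k d" using none insE by simp
  obtain z where "{v, z} \<in> ?F" "d {v, z} = d {u, w}" "\<gamma> \<in> colors_at ?F d z"
    using pendant_extend_or_core[OF cfd card2F new w g(1) gu g(2) none'] by metis
  then show False using gz duw by auto
qed

section \<open>Reduction at a vertex of degree three\<close>

text \<open>The edges of color \<open>a\<close> inside \<open>A\<close> are disjoint by properness
  and cover \<open>A\<close>, so they partition it into pairs.\<close>

lemma proper_matched_set_even:
  assumes proper: "proper_edge_coloring E k c"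
    and card2: "\<And>e. e \<in> E \<Longrightarrow> card e = 2" and fin: "finite A"
    and matched: "\<And>y. y \<in> A \<Longrightarrow> \<exists>x\<in>A. {y, x} \<in> E \<and> c {y, x} = a"
  shows "even (card A)"
proof -
  define M where "M = {e \<in> E. c e = a \<and> e \<subseteq> A}"
  have UM: "\<Union>M = A" using matched unfolding M_def by blast
  have "finite M" using fin by (rule_tac finite_subset[of _ "Pow A"]) (auto simp: M_def)
  moreover have "e \<inter> f = {}" if "e \<in> M" "f \<in> M" "e \<noteq> f" for e f
    using that proper unfolding M_def proper_edge_coloring_def by (metis (mono_tags, lifting) mem_Collect_eq)
  ultimately have "2 * card M = card (\<Union>M)"
    using UM fin card2 by (intro card_partition) (auto simp: M_def)
  with UM show ?thesis by (metis dvd_triv_left)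
qed

text \<open>By properness the two edges that the core provides at \<open>x\<close> are the only ones
  in these colors. So a core is a union of components of the graph formed by the two color
  classes.\<close>

lemma core_closed:
  assumes core: "bichromatic_core E c a b S" and proper: "proper_edge_coloring E k c"
    and x: "x \<in> S" "{x, y} \<in> E" "c {x, y} = a \<or> c {x, y} = b"
  shows "y \<in> S"
proof -
  obtain p q where "p \<in> S" "{x, p} \<in> E" "c {x, p} = a" "q \<in> S" "{x, q} \<in> E" "c {x, q} = b"
    using bichromatic_core_nbrs[OF core x(1)] by auto
  then show ?thesis using x proper_unique_nbr[OF proper x(2)] by metis
qed

text \<open>Every color below \<open>k\<close> other than those of \<open>v v1\<close> and
  \<open>v v2\<close> is proper at \<open>uv\<close>, hence closes a core and occurs at both
  \<open>w\<close> and \<open>v1\<close>. The color of \<open>v v1\<close> occurs there too. If that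
  of \<open>v v2\<close> did as well, all \<open>k\<close> colors would occur at a vertex of degree
  below \<open>k\<close>.\<close>

lemma saturated_ends:
  assumes fin: "finite F" and card2: "\<And>e. e \<in> F \<Longrightarrow> card e = 2" and new: "{u, v} \<notin> F"
    and w: "nbrs F u = {w}" and nv: "nbrs F v = {v1, v2}"
    and deg: "\<And>z. card (nbrs F z) < k"
    and cf: "core_free_coloring F k c" and eq: "c {u, w} = c {v, v1}"
    and none: "\<nexists>d. core_free_coloring (insert {u, v} F) k d"
  shows "c {v, v2} \<notin> colors_at F c w" and "c {v, v2} \<notin> colors_at F c v1"
    and "\<And>\<gamma>. \<gamma> < k \<Longrightarrow> \<gamma> \<noteq> c {v, v1} \<Longrightarrow> \<gamma> \<noteq> c {v, v2} \<Longrightarrow>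
      \<exists>S. bichromatic_core (insert {u, v} F) (c({u, v} := \<gamma>)) \<gamma> (c {v, v1}) S \<and> v \<in> S"
proof -
  have proper: "proper_edge_coloring F k c" using cf by (simp add: core_free_coloring_def)
  have edges: "{v, v1} \<in> F" "{u, w} \<in> F" using nv w by (auto simp: nbrs_def)
  have main: "\<gamma> \<in> colors_at F c w \<and> \<gamma> \<in> colors_at F c v1 \<and>
      (\<exists>S. bichromatic_core (insert {u, v} F) (c({u, v} := \<gamma>)) \<gamma> (c {v, v1}) S \<and> v \<in> S)"
    if g: "\<gamma> < k" "\<gamma> \<noteq> c {v, v1}" "\<gamma> \<noteq> c {v, v2}" for \<gamma>
  proof -
    have gv: "\<gamma> \<notin> colors_at F c v" using g nv by (auto simp: colors_at_def)
    have gu: "\<gamma> \<noteq> c {u, w}" using g eq by simp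
    obtain z S where z: "{v, z} \<in> F" "c {v, z} = c {u, w}" "\<gamma> \<in> colors_at F c w"
      "\<gamma> \<in> colors_at F c z"
      "bichromatic_core (insert {u, v} F) (c({u, v} := \<gamma>)) \<gamma> (c {u, w}) S" "v \<in> S"
      using pendant_extend_or_core[OF cf card2 new w g(1) gu gv none] by metis
    have "z = v1" using proper_unique_nbr[OF proper z(1) edges(1)] z(2) eq by simp
    with z eq show ?thesis by auto
  qed
  have "c {v, v1} \<in> colors_at F c w" "c {v, v1} \<in> colors_at F c v1"
    using edges eq unfolding colors_at_iff by (metis insert_commute)+
  then have sub: "{..<k} - {c {v, v2}} \<subseteq> colors_at F c y" if "y = w \<or> y = v1" for y
    using main that by blast
  have "c {v, v2} \<notin> colors_at F c y" if "y = w \<or> y = v1" for y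
  proof
    assume "c {v, v2} \<in> colors_at F c y"
    then have "{..<k} \<subseteq> colors_at F c y" using sub[OF that] by blast
    then have "k \<le> card (colors_at F c y)"
      using card_mono[OF finite_colors_at[OF fin, of c y], of "{..<k}"] by simp
    then show False using card_colors_at_le[OF fin, of c y] deg[of y] by linarith
  qed
  then show "c {v, v2} \<notin> colors_at F c w" "c {v, v2} \<notin> colors_at F c v1" by blast+
  show "\<And>\<gamma>. \<gamma> < k \<Longrightarrow> \<gamma> \<noteq> c {v, v1} \<Longrightarrow> \<gamma> \<noteq> c {v, v2} \<Longrightarrow>
      \<exists>S. bichromatic_core (insert {u, v} F) (c({u, v} := \<gamma>)) \<gamma> (c {v, v1}) S \<and> v \<in> S"
    using main by blast
qed

text \<open>With \<open>v v2\<close> removed, \<open>v v1\<close> is pendant and can take the color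
  of \<open>v v2\<close>. Putting \<open>v v2\<close> back in the old color of \<open>v v1\<close>
  is safe: a core through it would continue along \<open>v v1\<close> and require that color at
  \<open>v1\<close>, where it no longer occurs.\<close>

lemma core_free_swap:
  assumes card2: "\<And>e. e \<in> F \<Longrightarrow> card e = 2"
    and nv: "nbrs F v = {v1, v2}" and ne: "v1 \<noteq> v2"
    and cf: "core_free_coloring F k c"
    and q1: "c {v, v2} \<notin> colors_at F c v1" and p2: "c {v, v1} \<notin> colors_at F c v2"
  shows "core_free_coloring F k (c({v, v1} := c {v, v2}, {v, v2} := c {v, v1}))"
proof -
  define p q where "p = c {v, v1}" and "q = c {v, v2}"
  have proper: "proper_edge_coloring F k c" using cf by (simp add: core_free_coloring_def)
  have e: "{v, v1} \<in> F" "{v, v2} \<in> F" using nv by (auto simp: nbrs_def)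
  have v12: "v1 \<noteq> v" "v2 \<noteq> v" using card2[OF e(1)] card2[OF e(2)] by auto
  have pq: "p \<noteq> q" using proper_unique_nbr[OF proper e] ne by (auto simp: p_def q_def)
  have bounds: "p < k" "q < k" using e proper by (auto simp: p_def q_def proper_edge_coloring_def)
  let ?F = "F - {{v, v2}}" and ?c = "c({v, v1} := q)"
  have n1: "nbrs ?F v = {v1}" using nbrs_delete(2)[of v v2] v12 nv ne by auto
  have "core_free_coloring ?F k ?c"
  proof (rule core_free_recolor_pendant[OF _ _ n1 bounds(2)])
    show "core_free_coloring ?F k c" using cf core_free_coloring_mono by blast
    show "q \<notin> colors_at (?F - {{v, v1}}) c v1" using q1 by (auto simp: colors_at_iff q_def)
  qed (use card2 in auto)
  then have "core_free_coloring (insert {v, v2} ?F) k (?c({v, v2} := p))"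
  proof (rule core_free_extend)
    show "p \<notin> colors_at ?F ?c v" using n1 pq by (simp add: colors_at_def)
    show "p \<notin> colors_at ?F ?c v2"
      using p2 v12 ne by (auto simp: colors_at_iff p_def doubleton_eq_iff)
    have p1: "p \<notin> colors_at ?F ?c v1"
    proof
      assume "p \<in> colors_at ?F ?c v1"
      then obtain y where y: "{v1, y} \<in> F" "?c {v1, y} = p" by (auto simp: colors_at_iff)
      then have "y \<noteq> v" using pq by (auto simp: insert_commute)
      then have "c {v1, y} = c {v1, v}" using y v12 by (auto simp: p_def doubleton_eq_iff insert_commute)
      then show False using proper_unique_nbr[OF proper y(1), of v] e \<open>y \<noteq> v\<close> by (simp add: insert_commute)
    qed
    show "\<not> bichromatic_core (insert {v, v2} ?F) (?c({v, v2} := p)) p \<beta> S"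
      if bS: "\<beta> \<noteq> p" "v \<in> S" "v2 \<in> S" for \<beta> S
    proof
      assume core: "bichromatic_core (insert {v, v2} ?F) (?c({v, v2} := p)) p \<beta> S"
      show False
        by (rule core_at_new_edge[OF core _ bS(2,3,1)]) (use card2 n1 p1 in auto)
    qed
  qed (use card2 bounds in auto)
  then show ?thesis using e by (simp add: insert_absorb p_def q_def)
qed

text \<open>The hard case of a degree-three vertex: \<open>uw\<close> agrees in color with another
  edge at \<open>v\<close>. If no extension exists, the original and the swapped coloring each yield
  a core for the same \<open>\<gamma>\<close>, and the two are compared.\<close>

lemma three_vertex_extend:
  assumes fin: "finite F" and card2: "\<And>e. e \<in> F \<Longrightarrow> card e = 2" and new: "{u, v} \<notin> F"
    and w: "nbrs F u = {w}" and nv: "nbrs F v = {v1, v2}" and ne: "v1 \<noteq> v2"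
    and uv: "u \<noteq> v" and deg: "\<And>z. card (nbrs F z) < k" and k: "k \<ge> 3"
    and cf: "core_free_coloring F k c" and eq: "c {u, w} = c {v, v1}"
  shows "\<exists>d. core_free_coloring (insert {u, v} F) k d"
proof (rule ccontr)
  assume none: "\<nexists>d. core_free_coloring (insert {u, v} F) k d"
  define p q where "p = c {v, v1}" and "q = c {v, v2}"
  have proper: "proper_edge_coloring F k c" using cf by (simp add: core_free_coloring_def)
  have e: "{v, v1} \<in> F" "{v, v2} \<in> F" "{u, w} \<in> F" using nv w by (auto simp: nbrs_def)
  have v12: "v1 \<noteq> v" "v2 \<noteq> v" "w \<noteq> u" using card2[OF e(1)] card2[OF e(2)] card2[OF e(3)] by auto
  have v12u: "v1 \<noteq> u" "v2 \<noteq> u" "w \<noteq> v" using e new by (auto simp: insert_commute)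
  have pq: "p \<noteq> q" using proper_unique_nbr[OF proper e(1,2)] ne by (auto simp: p_def q_def)
  have bounds: "p < k" "q < k" using e proper by (auto simp: p_def q_def proper_edge_coloring_def)
  note sat1 = saturated_ends[OF fin card2 new w nv deg cf eq none, folded p_def q_def]
  have nv': "nbrs F v = {v2, v1}" using nv by auto

  \<comment> \<open>Giving \<open>uw\<close> the color of \<open>v v2\<close> exchanges the roles of
    \<open>v1\<close> and \<open>v2\<close>, which shows that \<open>p\<close> is missing at
    \<open>v2\<close>.\<close>
  define d where "d = c({u, w} := q)"
  have dv: "d {v, y} = c {v, y}" for y using uv v12u by (auto simp: d_def doubleton_eq_iff)
  have "core_free_coloring F k d" unfolding d_def
    by (rule core_free_recolor_pendant[OF cf card2 w bounds(2)]) (use sat1(1) in \<open>auto simp: colors_at_iff\<close>)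
  moreover have "d {u, w} = d {v, v2}" using dv by (simp add: d_def q_def)
  ultimately have "d {v, v1} \<notin> colors_at F d v2"
    using saturated_ends(2)[OF fin card2 new w nv' deg _ _ none] by blast
  then have "p \<notin> colors_at F d v2" using dv by (simp add: p_def)
  \<comment> \<open>\<open>v2\<close> meets \<open>q\<close> while \<open>w\<close> misses it, so
    the recolored edge \<open>uw\<close> does not touch \<open>v2\<close>.\<close>
  moreover have "v2 \<noteq> w"
    using sat1(1) e(2) unfolding colors_at_iff q_def by (metis insert_commute)
  then have "colors_at F d v2 = colors_at F c v2"
    using v12u by (intro colors_at_cong) (auto simp: d_def doubleton_eq_iff)
  ultimately have p2: "p \<notin> colors_at F c v2" by simp

  \<comment> \<open>After the swap \<open>uw\<close> agrees in color with \<open>v v2\<close>, so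
    \<open>saturated_ends\<close> applies with \<open>v1\<close> and \<open>v2\<close>
    exchanged.\<close>
  define d' where "d' = c({v, v1} := q, {v, v2} := p)"
  have cf': "core_free_coloring F k d'" unfolding d'_def p_def q_def
    using core_free_swap[OF card2 nv ne cf] sat1(2) p2 by (simp add: p_def q_def)
  have d': "d' {v, v1} = q" "d' {v, v2} = p" "d' {u, w} = p"
    using ne uv v12u eq by (auto simp: d'_def doubleton_eq_iff p_def)
  have eq': "d' {u, w} = d' {v, v2}" using d' by simp
  note sat2 = saturated_ends[OF fin card2 new w nv' deg cf' eq' none, unfolded d']

  have "card {p, q} < k" using k by (metis card_2_iff le_simps(2) less_le_trans numeral_2_eq_2
    numeral_3_eq_3 lessI pq)
  then obtain \<gamma> where g: "\<gamma> < k" "\<gamma> \<noteq> p" "\<gamma> \<noteq> q"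
    using ex_color_avoiding[of "{p, q}" k] by auto
  let ?E = "insert {u, v} F" and ?c = "c({u, v} := \<gamma>)" and ?d = "d'({u, v} := \<gamma>)"
  obtain S where S: "bichromatic_core ?E ?c \<gamma> p S" "v \<in> S" using sat1(3)[OF _ g] by blast
  obtain T where T: "bichromatic_core ?E ?d \<gamma> p T" "v \<in> T" using sat2(3)[OF _ g] by blast
  have proper': "proper_edge_coloring ?E k ?c"
    using g eq w nv by (intro proper_color_extend[OF proper card2]) (auto simp: colors_at_def p_def q_def)
  \<comment> \<open>Since \<open>v2\<close> misses \<open>p\<close> in the original coloring, it
    lies outside \<open>S\<close>; since \<open>p\<close> leads from \<open>v\<close> to
    \<open>v2\<close> after the swap, it lies in \<open>T\<close>.\<close>
  have v2p: "?c {v2, x} \<noteq> p" if "{v2, x} \<in> ?E" for x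
    using p2 that v12 v12u by (auto simp: colors_at_iff doubleton_eq_iff)
  have v2S: "v2 \<notin> S" using bichromatic_core_nbrs(2)[OF S(1)] v2p by blast
  have v2T: "v2 \<in> T"
  proof -
    obtain x where x: "x \<in> T" "{v, x} \<in> ?E" "?d {v, x} = p" using bichromatic_core_nbrs(2)[OF T] by blast
    then have "{v, x} \<noteq> {u, v}" using g by auto
    then have "x \<in> nbrs F v" "d' {v, x} = p" using x by (auto simp: nbrs_def)
    then show ?thesis using nv d' pq x(1) by auto
  qed
  have agree: "?c f = ?d f" if "f \<noteq> {v, v1}" "f \<noteq> {v, v2}" for f
    using that by (simp add: d'_def)
  have dd: "?d {v, v1} = q" "?d {v, v2} = p" using d' v12u uv by (auto simp: doubleton_eq_iff)
  let ?A = "T - S"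
  \<comment> \<open>The swap can close an alternating cycle \<open>T\<close> only through \<open>v v2\<close>. Outside the old cycle \<open>S\<close>,
    all vertices of \<open>T\<close> are matched in color \<open>\<gamma>\<close>, and all but \<open>v2\<close> are matched in color \<open>p\<close>,
    which is impossible by parity.\<close>
  have out: "x \<notin> S" if "y \<notin> S" "{y, x} \<in> ?E" "?c {y, x} = \<gamma> \<or> ?c {y, x} = p" for x y
    using core_closed[OF S(1) proper', of x y] that by (auto simp: insert_commute)
  have finA: "finite ?A"
  proof (rule finite_subset)
    show "?A \<subseteq> \<Union>?E" using T(1) by (auto simp: bichromatic_core_def)
    have "finite f" if "f \<in> F" for f using card2[OF that] by (metis card.infinite zero_neq_numeral)
    then show "finite (\<Union>?E)" using fin by auto
  qed
  have card2': "\<And>f. f \<in> ?E \<Longrightarrow> card f = 2" using card2 uv by auto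
  have "even (card ?A)"
  proof (rule proper_matched_set_even[OF proper' card2' finA])
    fix y assume y: "y \<in> ?A"
    then obtain x where x: "x \<in> T" "{y, x} \<in> ?E" "?d {y, x} = \<gamma>"
      using bichromatic_core_nbrs(1)[OF T(1)] by blast
    then have "{y, x} \<noteq> {v, v1}" "{y, x} \<noteq> {v, v2}" using dd g by metis+
    then have "?c {y, x} = \<gamma>" using agree x(3) by simp
    then show "\<exists>x\<in>?A. {y, x} \<in> ?E \<and> ?c {y, x} = \<gamma>" using out y x by blast
  qed
  moreover have "even (card (?A - {v2}))"
  proof (rule proper_matched_set_even[OF proper' card2' finite_Diff[OF finA]])
    fix y assume y: "y \<in> ?A - {v2}"
    then obtain x where x: "x \<in> T" "{y, x} \<in> ?E" "?d {y, x} = p"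
      using bichromatic_core_nbrs(2)[OF T(1)] by blast
    then have "{y, x} \<noteq> {v, v1}" using dd pq by metis
    moreover have "{y, x} \<noteq> {v, v2}" using y S(2) by (auto simp: doubleton_eq_iff)
    ultimately have cp: "?c {y, x} = p" using agree x(3) by simp
    then have "x \<notin> S" using out y x by blast
    \<comment> \<open>Removing \<open>v2\<close> costs no vertex its partner, because no edge at
      \<open>v2\<close> has color \<open>p\<close> under \<open>?c\<close>.\<close>
    moreover have "x \<noteq> v2" using v2p[of y] cp x(2) by (metis insert_commute)
    ultimately show "\<exists>x\<in>?A - {v2}. {y, x} \<in> ?E \<and> ?c {y, x} = p" using x cp by blast
  qed
  moreover have "card ?A = Suc (card (?A - {v2}))"
    using v2S v2T finA by (metis DiffI card_Suc_Diff1)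
  ultimately show False by simp
qed

lemma reduce_three_vertex:
  assumes fin: "finite E" and card2: "\<And>e. e \<in> E \<Longrightarrow> card e = 2"
    and e: "{u, v} \<in> E" and u: "card (nbrs E u) = 2" and v: "card (nbrs E v) = 3"
    and deg: "\<And>z. card (nbrs E z) < k"
    and cf: "core_free_coloring (E - {{u, v}}) k c"
  shows "\<exists>d. core_free_coloring E k d"
proof -
  let ?F = "E - {{u, v}}"
  have uv: "u \<noteq> v" using card2[OF e] by auto
  have vu: "v \<in> nbrs E u" "u \<in> nbrs E v" using e by (auto simp: nbrs_def insert_commute)
  have "card (nbrs ?F u) = 1" using nbrs_delete(2)[OF uv] vu u by simp
  then obtain w where w: "nbrs ?F u = {w}" by (meson card_1_singletonE)
  have "card (nbrs ?F v) = 2" using nbrs_delete(1)[OF uv] vu v by simp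
  then obtain v1 v2 where nv: "nbrs ?F v = {v1, v2}" and ne: "v1 \<noteq> v2" by (meson card_2_iff)
  have nv': "nbrs ?F v = {v2, v1}" using nv by auto
  have insE: "insert {u, v} ?F = E" using e by auto
  have finF: "finite ?F" and card2F: "\<And>e. e \<in> ?F \<Longrightarrow> card e = 2" and new: "{u, v} \<notin> ?F"
    using fin card2 by auto
  have degF: "card (nbrs ?F z) < k" for z
  proof -
    have "card (nbrs ?F z) \<le> card (nbrs E z)"
      using finite_nbrs[OF fin] by (rule card_mono) (auto simp: nbrs_def)
    then show ?thesis using deg[of z] by linarith
  qed
  have k: "k \<ge> 4" using deg[of v] v by linarith
  consider "c {u, w} = c {v, v1}" | "c {u, w} = c {v, v2}"
    | "c {u, w} \<noteq> c {v, v1}" "c {u, w} \<noteq> c {v, v2}" by blast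
  then show ?thesis
  proof cases
    case 1
    then show ?thesis
      using three_vertex_extend[OF finF card2F new w nv ne uv degF _ cf] k insE by auto
  next
    case 2
    then show ?thesis
      using three_vertex_extend[OF finF card2F new w nv' ne[symmetric] uv degF _ cf] k insE by auto
  next
    case 3
    \<comment> \<open>At most three colors are excluded and \<open>k \<ge> 4\<close>; a core through
      \<open>uv\<close> would need another edge at \<open>v\<close> in the color of
      \<open>uw\<close>.\<close>
    have "card {c {u, w}, c {v, v1}, c {v, v2}} \<le> 3" by (simp add: card_insert_if)
    then obtain \<gamma> where g: "\<gamma> < k" "\<gamma> \<notin> {c {u, w}, c {v, v1}, c {v, v2}}"
      using ex_color_avoiding[of "{c {u, w}, c {v, v1}, c {v, v2}}" k] k by auto
    have gv: "\<gamma> \<notin> colors_at ?F c v" using g nv by (auto simp: colors_at_def)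
    have gu: "\<gamma> \<noteq> c {u, w}" using g by auto
    show ?thesis
    proof (rule ccontr)
      assume "\<nexists>d. core_free_coloring E k d"
      then have none: "\<nexists>d. core_free_coloring (insert {u, v} ?F) k d" using insE by simp
      obtain z where z: "{v, z} \<in> ?F" "c {v, z} = c {u, w}"
        using pendant_extend_or_core[OF cf card2F new w g(1) gu gv none] by metis
      have "z \<in> {v1, v2}" using z(1) unfolding nv[symmetric] nbrs_def by simp
      then show False using z(2) 3 by auto
    qed
  qed
qed

section \<open>Discharging\<close>

lemma handshake:
  assumes fin: "finite E" and card2: "\<And>e. e \<in> E \<Longrightarrow> card e = 2"
  shows "(\<Sum>v\<in>\<Union>E. card (nbrs E v)) = 2 * card E"
proof -
  have "finite e" if "e \<in> E" for e using card2[OF that] by (metis card.infinite zero_neq_numeral)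
  then have "finite (\<Union>E)" using fin by auto
  moreover have "{v \<in> \<Union>E. v \<in> e} = e" if "e \<in> E" for e using that by auto
  ultimately have "(\<Sum>v\<in>\<Union>E. card {e \<in> E. v \<in> e}) = 2 * card E"
    using fin card2 by (intro sum_multicount) auto
  then show ?thesis by (simp add: card_nbrs[OF card2] degree_def)
qed

text \<open>Discharging: if every vertex gives \<open>1/2\<close> to each of its neighbors of degree two, then without
  the listed configurations every vertex keeps charge at least three.\<close>

lemma ex_reducible_edge:
  assumes fin: "finite E" and card2: "\<And>e. e \<in> E \<Longrightarrow> card e = 2"
    and sparse: "2 * card E < 3 * card (\<Union>E)"
  shows "\<exists>u v. {u, v} \<in> E \<and> (nbrs E u = {v} \<or> card (nbrs E u) = 2 \<and>
    (card (nbrs E v) = 3 \<or> (\<exists>x. \<forall>z\<in>nbrs E v. z \<noteq> x \<longrightarrow> card (nbrs E z) \<le> 2)))"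
proof (rule ccontr)
  assume "\<not> ?thesis"
  then have no1: "\<And>u v. {u, v} \<in> E \<Longrightarrow> nbrs E u \<noteq> {v}"
    and no2: "\<And>u v. {u, v} \<in> E \<Longrightarrow> card (nbrs E u) = 2 \<Longrightarrow> card (nbrs E v) \<noteq> 3"
    and no3: "\<And>u v x. {u, v} \<in> E \<Longrightarrow> card (nbrs E u) = 2 \<Longrightarrow>
      \<exists>z\<in>nbrs E v. z \<noteq> x \<and> 2 < card (nbrs E z)"
    by (meson not_le)+
  define V where "V = \<Union>E"
  define V2 where "V2 = {u \<in> V. card (nbrs E u) = 2}"
  define t where "t v = card {u \<in> V2. {u, v} \<in> E}" for v
  have "finite e" if "e \<in> E" for e using card2[OF that] by (metis card.infinite zero_neq_numeral)
  then have finV: "finite V" using fin by (auto simp: V_def)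
  then have finV2: "finite V2" by (simp add: V2_def)
  have deg2: "card (nbrs E v) \<ge> 2" if v: "v \<in> V" for v
  proof -
    obtain e where e: "e \<in> E" "v \<in> e" using v by (auto simp: V_def)
    obtain x where "e = {v, x}" using edge_endpoints[OF card2[OF e(1)] e(2)] by metis
    then have x: "x \<in> nbrs E v" using e by (simp add: nbrs_def)
    then have "card (nbrs E v) \<noteq> 0" using finite_nbrs[OF fin] by auto
    moreover have "card (nbrs E v) \<noteq> 1"
    proof
      assume "card (nbrs E v) = 1"
      then obtain y where "nbrs E v = {y}" by (meson card_1_singletonE)
      moreover from this have "{v, y} \<in> E" by (auto simp: nbrs_def)
      ultimately show False using no1 by blast
    qed
    ultimately show ?thesis by linarith
  qed
  \<comment> \<open>Twice the final charge is at least six, written without fractions or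
    subtraction: \<open>v\<close> gives away \<open>t v\<close> halves, and a vertex of degree two
    receives two halves.\<close>
  have charge: "t v + 6 \<le> 2 * card (nbrs E v) + (if card (nbrs E v) = 2 then 2 else 0)"
    if v: "v \<in> V" for v
  proof (cases "{u \<in> V2. {u, v} \<in> E} = {}")
    case True
    then have "t v = 0" unfolding t_def by (metis card.empty)
    then show ?thesis using deg2[OF v] by auto
  next
    case False
    then obtain u where u: "{u, v} \<in> E" "card (nbrs E u) = 2" by (auto simp: V2_def)
    obtain z1 where z1: "z1 \<in> nbrs E v" "card (nbrs E z1) > 2" using no3[OF u] by blast
    obtain z2 where z2: "z2 \<in> nbrs E v" "z2 \<noteq> z1" "card (nbrs E z2) > 2" using no3[OF u] by blast
    have "{u \<in> V2. {u, v} \<in> E} \<subseteq> nbrs E v - {z1, z2}"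
      using z1 z2 by (auto simp: V2_def nbrs_def insert_commute)
    then have "t v \<le> card (nbrs E v - {z1, z2})"
      unfolding t_def using finite_nbrs[OF fin] by (intro card_mono) auto
    also have "\<dots> = card (nbrs E v) - 2"
      using z1 z2 finite_nbrs[OF fin] by (simp add: card_Diff_subset)
    finally have "t v \<le> card (nbrs E v) - 2" .
    \<comment> \<open>Positivity rules out degree two, where the bound gives \<open>t v = 0\<close>.
      Degree three is excluded by \<open>no2\<close>, and from degree four on the bound
      suffices.\<close>
    moreover have "t v > 0" using False finV2 by (simp add: t_def card_gt_0_iff)
    ultimately show ?thesis using no2[OF u] by auto
  qed
  have "(\<Sum>v\<in>V. t v) = 2 * card V2"
    unfolding t_def
  proof (rule sum_multicount[OF finV finV2], rule ballI)
    fix u assume "u \<in> V2"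
    moreover have "{v \<in> V. {u, v} \<in> E} = nbrs E u" by (auto simp: V_def nbrs_def)
    ultimately show "card {v \<in> V. {u, v} \<in> E} = 2" by (simp add: V2_def)
  qed
  moreover have "(\<Sum>v\<in>V. t v + 6) \<le>
      (\<Sum>v\<in>V. 2 * card (nbrs E v) + (if card (nbrs E v) = 2 then 2 else 0))"
    using charge by (rule sum_mono)
  moreover have "(\<Sum>v\<in>V. if card (nbrs E v) = 2 then 2 else 0) = 2 * card V2"
    unfolding V2_def using finV by (simp flip: sum.inter_filter)
  moreover have "(\<Sum>v\<in>V. 2 * card (nbrs E v)) = 4 * card E"
    using handshake[OF fin card2] by (simp add: V_def flip: sum_distrib_left)
  \<comment> \<open>The contributions of \<open>V2\<close> cancel, leaving
    \<open>6 * card V \<le> 4 * card E\<close>.\<close>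
  ultimately show False using sparse by (simp add: sum.distrib V_def)
qed

section \<open>Induction on the edge set and the link to maximum average degree\<close>

text \<open>The induction deletes a reducible edge. Sparsity is demanded of all nonempty edge
  subsets, and \<open>k\<close> is a fixed degree bound rather than tied to the maximum degree of
  the current graph, so both hypotheses survive the deletion.\<close>

lemma sparse_core_free_coloring:
  assumes "finite E" "\<And>e. e \<in> E \<Longrightarrow> card e = 2"
    and "\<And>F. F \<subseteq> E \<Longrightarrow> F \<noteq> {} \<Longrightarrow> 2 * card F < 3 * card (\<Union>F)"
    and "\<And>z. card (nbrs E z) < k"
  shows "\<exists>c. core_free_coloring E k c"
  using assms
proof (induction E rule: finite_psubset_induct)
  case (psubset E)
  note card2 = psubset.prems(1) and sparse = psubset.prems(2) and deg = psubset.prems(3)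
  show ?case
  proof (cases "E = {}")
    case True
    then show ?thesis
      by (auto simp: core_free_coloring_def proper_edge_coloring_def bichromatic_core_def)
  next
    case False
    obtain u v where e: "{u, v} \<in> E" and config: "nbrs E u = {v} \<or> card (nbrs E u) = 2 \<and>
        (card (nbrs E v) = 3 \<or> (\<exists>x. \<forall>z\<in>nbrs E v. z \<noteq> x \<longrightarrow> card (nbrs E z) \<le> 2))"
      using ex_reducible_edge[OF psubset.hyps card2 sparse[OF subset_refl False]] by blast
    let ?F = "E - {{u, v}}"
    have "card (nbrs ?F z) < k" for z
    proof -
      have "card (nbrs ?F z) \<le> card (nbrs E z)"
        using finite_nbrs[OF psubset.hyps] by (rule card_mono) (auto simp: nbrs_def)
      then show ?thesis using deg[of z] by linarith
    qed
    moreover have "2 * card F' < 3 * card (\<Union>F')" if "F' \<subseteq> ?F" "F' \<noteq> {}" for F'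
      using sparse that by blast
    moreover have "?F \<subset> E" using e by blast
    ultimately obtain c where cf: "core_free_coloring ?F k c"
      using psubset.IH[of ?F] card2 by blast
    show ?thesis
      using config reduce_degree_one[OF psubset.hyps card2 e _ deg cf]
        reduce_three_vertex[OF psubset.hyps card2 e _ _ deg cf]
        reduce_mostly_light_nbrs[OF psubset.hyps card2 e _ deg _ cf] by blast
  qed
qed

lemma degree_le_max_degree:
  assumes "simple_graph V E" "finite V"
  shows "degree E v \<le> max_degree V E"
proof (cases "v \<in> V")
  case True
  then show ?thesis using assms(2) by (auto simp: max_degree_def intro!: Max_ge)
next
  case False
  then have "{e \<in> E. v \<in> e} = {}" using assms(1) by (auto simp: simple_graph_def)
  then show ?thesis unfolding degree_def by (metis card.empty le0)
qed

text \<open>\<open>F\<close> with the vertices it covers is one of the competing subgraphs. Since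
  \<open>V\<close> is finite, the averages form a finite set, so \<open>Max\<close> really bounds
  them.\<close>

lemma average_degree_le_max:
  assumes G: "simple_graph V E" and fin: "finite V" and F: "F \<subseteq> E" "F \<noteq> {}"
  shows "2 * real (card F) / real (card (\<Union>F)) \<le> max_average_degree V E"
proof -
  let ?A = "{2 * real (card F) / real (card W) | W F. subgraph W F V E \<and> W \<noteq> {}}"
  have E: "E \<subseteq> Pow V" using G by (auto simp: simple_graph_def)
  have "?A \<subseteq> (\<lambda>(W, F). 2 * real (card F) / real (card W)) ` (Pow V \<times> Pow E)"
    by (auto simp: subgraph_def)
  moreover have "finite (Pow V \<times> Pow E)" using fin E by (simp add: finite_subset)
  ultimately have "finite ?A" by (meson finite_imageI finite_subset)
  moreover obtain e where e: "e \<in> F" using F by blast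
  then have "card e = 2" using F G by (auto simp: simple_graph_def)
  then have "e \<noteq> {}" by auto
  then have ne: "\<Union>F \<noteq> {}" using e by blast
  moreover have "\<Union>F \<subseteq> V" using E F by blast
  moreover from this have "subgraph (\<Union>F) F V E"
    using G F by (auto simp: subgraph_def simple_graph_def)
  ultimately have "2 * real (card F) / real (card (\<Union>F)) \<le> Max ?A"
    by (intro Max_ge) blast+
  then show ?thesis using ne \<open>\<Union>F \<subseteq> V\<close> by (auto simp: max_average_degree_def)
qed

theorem theorem2:
  fixes V :: "'a set" and E :: "'a set set"
  assumes "simple_graph V E" and "finite V"
    and "max_average_degree V E < 3"
  shows "acyclic_chromatic_index E \<le> max_degree V E + 1"
proof -
  have E: "E \<subseteq> Pow V" and card2: "\<And>e. e \<in> E \<Longrightarrow> card e = 2"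
    using assms(1) by (auto simp: simple_graph_def)
  have fin: "finite E" using E assms(2) by (simp add: finite_subset)
  have "2 * card F < 3 * card (\<Union>F)" if F: "F \<subseteq> E" "F \<noteq> {}" for F
  proof -
    obtain e where e: "e \<in> F" using F by blast
    have "finite (\<Union>F)" using E F assms(2) by (meson Sup_le_iff Pow_iff finite_subset subsetD)
    moreover have "e \<noteq> {}" using card2 e F by fastforce
    ultimately have "card (\<Union>F) > 0" using e by (auto simp: card_gt_0_iff)
    moreover have "2 * real (card F) / real (card (\<Union>F)) < 3"
      using average_degree_le_max[OF assms(1,2) F] assms(3) by linarith
    ultimately have "2 * real (card F) < 3 * real (card (\<Union>F))" by (simp add: divide_less_eq)
    then show ?thesis by linarith
  qed
  \<comment> \<open>The number of colors must strictly exceed every degree; this is the source of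
    the \<open>+ 1\<close>.\<close>
  moreover have "card (nbrs E z) < max_degree V E + 1" for z
    using degree_le_max_degree[OF assms(1,2), of z] card_nbrs[OF card2] by (simp add: less_Suc_eq_le)
  ultimately obtain c where "core_free_coloring E (max_degree V E + 1) c"
    using sparse_core_free_coloring[OF fin card2] by blast
  then show ?thesis
    unfolding acyclic_chromatic_index_def by (intro Least_le exI) (rule core_free_imp_acyclic)
qed

end
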